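(* Let $X$ be a non-negative random variable with $0<\mathbb{E}X<\infty$ that admits a $1$-bounded size bias coupling, and let $Y$ be a random variable whose distribution is that of $X$ conditional on $X>0$. Then there is a coupling of $X$ and $Y$ in which $Y(\omega)-X(\omega)\in[0,1]$ for all $\omega$ in the underlying probability space.
   Context: For a non-negative random variable $X$ with $0<\mathbb{E}X<\infty$, a random variable $Z$ is said to have the size biased distribution of $X$, written $Z=^d X^*$, if $\mathbb{P}(Z\in dx)/\mathbb{P}(X\in dx)=x/\mathbb{E}X$ (Radon–Nikodym derivative), i.e. $\mathbb{E}\,g(Z)=\mathbb{E}(Xg(X))/\mathbb{E}X$ for all bounded measurable $g$. A coupling of two random variables (with specified distributions) is a pair of random variables on a common probability space having those distributions as marginals. We say that $X$ admits a $1$-bounded size bias coupling if there is a coupling of $X$ with $Z=^dX^*$ in which $Z\le X+1$ almost surely. *)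

theory Defs
  imports "HOL-Probability.Probability"
begin

definition coupling ::
  "'c measure \<Rightarrow> ('c \<Rightarrow> real) \<Rightarrow> ('c \<Rightarrow> real) \<Rightarrow> real measure \<Rightarrow> real measure \<Rightarrow> bool"
where
  "coupling N U V \<mu> \<nu> \<longleftrightarrow>
     prob_space N \<and> U \<in> borel_measurable N \<and> V \<in> borel_measurable N \<and>
     distr N borel U = \<mu> \<and> distr N borel V = \<nu>"

(* Meant for laws on the half-line with finite positive mean; ennreal would cut off
   the negative values of the density. *)
definition size_bias_law :: "real measure \<Rightarrow> real measure" where
  "size_bias_law \<mu> = density \<mu> (\<lambda>x. ennreal (x / (\<integral>t. t \<partial>\<mu>)))"

lemma integral_size_bias_law:
  fixes X g :: "_ \<Rightarrow> real"
  assumes X: "X \<in> borel_measurable M" and nonneg: "AE \<omega> in M. 0 \<le> X \<omega>"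
    and pos: "0 < (\<integral>\<omega>. X \<omega> \<partial>M)" and g: "g \<in> borel_measurable borel"
  shows "(\<integral>z. g z \<partial>size_bias_law (distr M borel X)) = (\<integral>\<omega>. X \<omega> * g (X \<omega>) \<partial>M) / (\<integral>\<omega>. X \<omega> \<partial>M)"
proof -
  let ?m = "\<integral>\<omega>. X \<omega> \<partial>M"
  have m: "(\<integral>t. t \<partial>distr M borel X) = ?m"
    using X by (simp add: integral_distr)
  have ae: "AE x in distr M borel X. 0 \<le> x / ?m"
    using X nonneg pos by (simp add: AE_distr_iff zero_le_divide_iff)
  have "(\<integral>z. g z \<partial>size_bias_law (distr M borel X)) = (\<integral>x. (x / ?m) *\<^sub>R g x \<partial>distr M borel X)"
    unfolding size_bias_law_def m using g ae by (intro integral_density) auto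
  also have "\<dots> = (\<integral>\<omega>. (X \<omega> * g (X \<omega>)) / ?m \<partial>M)"
    using X g by (simp add: integral_distr)
  finally show ?thesis
    by simp
qed

(* The coupling may live on any probability space N. *)
definition bounded_size_bias_coupling ::
  "real \<Rightarrow> 'c measure \<Rightarrow> ('c \<Rightarrow> real) \<Rightarrow> ('c \<Rightarrow> real) \<Rightarrow> real measure \<Rightarrow> bool"
where
  "bounded_size_bias_coupling c N U Z \<mu> \<longleftrightarrow>
     coupling N U Z \<mu> (size_bias_law \<mu>) \<and> (AE \<omega> in N. Z \<omega> \<le> U \<omega> + c)"

end

theory Submission
  imports Defs
begin

text \<open>
  The law of \<open>Y\<close> lies between the laws of \<open>X\<close> and \<open>X + 1\<close> in the stochastic order, and
  stochastic order between several laws on the line is realised simultaneously by their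
  quantile functions on \<open>(0,1)\<close>.

  The comparison of \<open>X\<close> with \<open>Y\<close> is immediate, since conditioning on \<open>X > 0\<close> divides the tails
  at non-negative levels by \<open>P(X > 0) \<le> 1\<close>. The comparison of \<open>Y\<close> with \<open>X + 1\<close> passes through
  the size biased variable \<open>Z\<close>. Conditioning on \<open>X > 0\<close> does not change the size biased law,
  so \<open>Z\<close> is also a size biased version of \<open>Y\<close>, and a variable is stochastically dominated by
  its size biased version because an increasing weight shifts mass upwards
  (\<open>conditional_tail_le_size_bias_tail\<close>). Finally \<open>Z \<le> U + 1\<close> with \<open>U\<close> distributed as \<open>X\<close> gives
  the domination of \<open>Z\<close> by \<open>X + 1\<close>. Translated into distribution functions \<open>F\<close> of \<open>X\<close> and
  \<open>G\<close> of \<open>Y\<close>, this reads \<open>F(x) \<le> G(x + 1)\<close> and \<open>G(x) \<le> F(x)\<close>, which is what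
  \<open>quantile_coupling\<close> needs.
\<close>

text \<open>
  The generalised inverse \<open>I\<close> of a distribution function \<open>F\<close>, evaluated at a uniform variable,
  has the law it came from, and \<open>\<omega> \<le> F x \<longleftrightarrow> I \<omega> \<le> x\<close> turns upper bounds on a distribution
  function into lower bounds on its inverse. The equivalence holds at every \<open>\<omega>\<close> strictly
  between 0 and 1, so with the uniform law on the open interval the bounds hold at every point
  of the space, not just almost surely.
\<close>

lemma quantile_coupling:
  fixes \<mu> \<nu> :: "real measure"
  assumes "real_distribution \<mu>" "real_distribution \<nu>"
    and le: "\<And>x. cdf \<nu> x \<le> cdf \<mu> x"
    and shift: "\<And>x. cdf \<mu> x \<le> cdf \<nu> (x + c)"
  shows "\<exists>(\<Omega> :: real measure) V W. coupling \<Omega> V W \<mu> \<nu> \<and> (\<forall>\<omega>\<in>space \<Omega>. W \<omega> - V \<omega> \<in> {0..c})"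
proof -
  interpret \<mu>: cdf_distribution \<mu>
    using assms(1) by (simp add: cdf_distribution_def)
  interpret \<nu>: cdf_distribution \<nu>
    using assms(2) by (simp add: cdf_distribution_def)
  let ?\<Omega> = "restrict_space lborel {0<..<1} :: real measure"
  have "prob_space ?\<Omega>"
    by (auto simp: space_restrict_space emeasure_restrict_space intro!: prob_spaceI)
  moreover have "\<mu>.I \<in> borel_measurable ?\<Omega>" "\<nu>.I \<in> borel_measurable ?\<Omega>"
    using \<mu>.measurable_CI \<nu>.measurable_CI
    by (simp_all cong: measurable_cong_sets add: sets_restrict_space)
  moreover have "\<nu>.I \<omega> - \<mu>.I \<omega> \<in> {0..c}" if "\<omega> \<in> space ?\<Omega>" for \<omega>
  proof -
    have \<omega>: "0 < \<omega>" "\<omega> < 1"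
      using that by (auto simp: space_restrict_space)
    have "\<omega> \<le> cdf \<mu> (\<nu>.I \<omega>)"
      using \<nu>.pseudoinverse[OF \<omega>, of "\<nu>.I \<omega>"] le order_trans by blast
    moreover have "\<omega> \<le> cdf \<nu> (\<mu>.I \<omega> + c)"
      using \<mu>.pseudoinverse[OF \<omega>, of "\<mu>.I \<omega>"] shift order_trans by blast
    ultimately show ?thesis
      using \<mu>.pseudoinverse[OF \<omega>, of "\<nu>.I \<omega>"] \<nu>.pseudoinverse[OF \<omega>, of "\<mu>.I \<omega> + c"]
      by simp
  qed
  ultimately show ?thesis
    unfolding coupling_def using \<mu>.distr_I_eq_M \<nu>.distr_I_eq_M by blast
qed

text \<open>
  Enlarging the underlying space by an independent factor changes no law; this serves to place
  a coupling on a product space.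
\<close>

lemma coupling_fst:
  assumes "coupling N U V \<mu> \<nu>" and "prob_space K"
  shows "coupling (N \<Otimes>\<^sub>M K) (U \<circ> fst) (V \<circ> fst) \<mu> \<nu>"
proof -
  interpret K: prob_space K by fact
  interpret N: prob_space N
    using assms(1) by (simp add: coupling_def)
  interpret P: pair_prob_space N K ..
  have [measurable]: "U \<in> borel_measurable N" "V \<in> borel_measurable N"
    using assms(1) by (simp_all add: coupling_def)
  have "distr (N \<Otimes>\<^sub>M K) borel (f \<circ> fst) = distr N borel f" if "f \<in> borel_measurable N"
    for f :: "'a \<Rightarrow> real"
    using distr_distr[OF that measurable_fst, of K] by (simp add: K.distr_pair_fst)
  then show ?thesis
    using assms(1) P.prob_space_axioms by (auto simp: coupling_def)
qed

text \<open>
  After division by the mean and by \<open>P(X > 0)\<close> this says that the tail of \<open>X\<close> conditioned on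
  \<open>X > 0\<close> is at most the tail of its size biased version. With \<open>p = P(X > t)\<close> and
  \<open>q = P(0 < X \<le> t)\<close>, the part of the mean above \<open>t\<close> is at least \<open>t p\<close> and the part below is
  at most \<open>t q\<close>, so \<open>E(X; X \<le> t) p \<le> t q p \<le> q E(X; X > t)\<close>; adding \<open>p E(X; X > t)\<close> on both sides gives the claim.
\<close>

lemma (in prob_space) conditional_tail_le_size_bias_tail:
  fixes X :: "'a \<Rightarrow> real"
  assumes int: "integrable M X" and nonneg: "AE \<omega> in M. 0 \<le> X \<omega>" and "0 \<le> t"
  shows "expectation X * \<P>(\<omega> in M. t < X \<omega>)
    \<le> \<P>(\<omega> in M. 0 < X \<omega>) * expectation (\<lambda>\<omega>. X \<omega> * indicator {t<..} (X \<omega>))"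
proof -
  have [measurable]: "X \<in> borel_measurable M"
    using int by simp
  let ?A = "{\<omega> \<in> space M. t < X \<omega>}" and ?B = "{\<omega> \<in> space M. 0 < X \<omega> \<and> X \<omega> \<le> t}"
  let ?high = "\<lambda>\<omega>. X \<omega> * indicator {t<..} (X \<omega>)" and ?low = "\<lambda>\<omega>. X \<omega> * indicator {..t} (X \<omega>)"
  have high: "integrable M ?high" and low: "integrable M ?low"
    by (rule Bochner_Integration.integrable_bound[OF int]; auto simp: indicator_def)+
  have "expectation X = expectation (\<lambda>\<omega>. ?high \<omega> + ?low \<omega>)"
    by (rule Bochner_Integration.integral_cong) (auto simp: indicator_def)
  then have mean: "expectation X = expectation ?high + expectation ?low"
    using high low by simp
  have weighted: "integrable M (\<lambda>\<omega>. t * indicator A \<omega>)" if "A \<in> events" for A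
    using that by (intro integrable_mult_right integrable_real_indicator)
      (auto simp: emeasure_eq_measure)
  have "t * prob ?A = expectation (\<lambda>\<omega>. t * indicator ?A \<omega>)"
    by simp
  also have "\<dots> \<le> expectation ?high"
    using high by (intro integral_mono weighted) (auto simp: indicator_def)
  finally have upper: "t * prob ?A \<le> expectation ?high" .
  have "AE \<omega> in M. ?low \<omega> \<le> t * indicator ?B \<omega>"
    using nonneg AE_space by eventually_elim (auto simp: indicator_def)
  then have "expectation ?low \<le> expectation (\<lambda>\<omega>. t * indicator ?B \<omega>)"
    using low by (intro integral_mono_AE weighted) auto
  also have "\<dots> = t * prob ?B"
    by simp
  finally have lower: "expectation ?low \<le> t * prob ?B" .
  have "prob (?A \<union> ?B) = prob ?A + prob ?B"
    by (rule finite_measure_Union) auto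
  moreover have "?A \<union> ?B = {\<omega> \<in> space M. 0 < X \<omega>}"
    using \<open>0 \<le> t\<close> by auto
  ultimately have split: "\<P>(\<omega> in M. 0 < X \<omega>) = prob ?A + prob ?B"
    by simp
  have "expectation ?low * prob ?A \<le> (t * prob ?B) * prob ?A"
    using lower by (intro mult_right_mono) auto
  also have "\<dots> = prob ?B * (t * prob ?A)"
    by simp
  also have "\<dots> \<le> prob ?B * expectation ?high"
    using upper by (intro mult_left_mono) auto
  finally show ?thesis
    by (simp add: mean split algebra_simps)
qed

lemma (in real_distribution) cdf_eq_one_minus_tail: "cdf M x = 1 - measure M {x<..}"
proof -
  have "measure M (space M - {x<..}) = 1 - measure M {x<..}"
    by (rule prob_compl) simp
  moreover have "space M - {x<..} = {..x}"
    by auto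
  ultimately show ?thesis
    by (simp add: cdf_def)
qed

theorem corollary7p2:
  fixes M :: "'a measure" and X :: "'a \<Rightarrow> real"
    and N :: "'b measure" and U Z :: "'b \<Rightarrow> real"
    and K :: "'c measure" and Y :: "'c \<Rightarrow> real"
  assumes "prob_space M" and "X \<in> borel_measurable M"
    and "AE \<omega> in M. 0 \<le> X \<omega>"
    and "integrable M X" and "0 < (\<integral>\<omega>. X \<omega> \<partial>M)"
    and "bounded_size_bias_coupling 1 N U Z (distr M borel X)"
    and "prob_space K" and "Y \<in> borel_measurable K"
    and "\<And>B. B \<in> sets borel \<Longrightarrow>
      \<P>(\<omega> in K. Y \<omega> \<in> B) = \<P>(\<omega> in M. X \<omega> \<in> B \<bar> X \<omega> > 0)"
  shows "\<exists>(P :: (real \<times> real) measure) X' Y'.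
    coupling P X' Y' (distr M borel X) (distr K borel Y) \<and>
    (\<forall>\<omega>\<in>space P. Y' \<omega> - X' \<omega> \<in> {0..1})"
proof -
  interpret M: prob_space M by fact
  interpret K: prob_space K by fact
  note [measurable] = \<open>X \<in> borel_measurable M\<close> \<open>Y \<in> borel_measurable K\<close>
  let ?\<mu> = "distr M borel X" and ?\<nu> = "distr K borel Y" and ?m = "\<integral>\<omega>. X \<omega> \<partial>M"
  interpret \<mu>: real_distribution ?\<mu>
    by (rule M.real_distribution_distr) simp
  interpret \<nu>: real_distribution ?\<nu>
    by (rule K.real_distribution_distr) simp
  have NZ: "prob_space N" and [measurable]: "U \<in> borel_measurable N" "Z \<in> borel_measurable N"
    and U: "distr N borel U = ?\<mu>" and Z: "distr N borel Z = size_bias_law ?\<mu>"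
    and ZU: "AE \<omega> in N. Z \<omega> \<le> U \<omega> + 1"
    using assms(6) by (auto simp: bounded_size_bias_coupling_def coupling_def)
  interpret N: prob_space N by fact
  let ?p = "\<P>(\<omega> in M. 0 < X \<omega>)"
  have tail_X: "measure ?\<mu> {t<..} = \<P>(\<omega> in M. t < X \<omega>)" for t
    by (auto simp: measure_distr intro!: arg_cong[where f = M.prob])
  have tail_Y: "measure ?\<nu> {t<..} = \<P>(\<omega> in M. max t 0 < X \<omega>) / ?p" for t
  proof -
    have "measure ?\<nu> {t<..} = \<P>(\<omega> in K. Y \<omega> \<in> {t<..})"
      by (auto simp: measure_distr intro!: arg_cong[where f = K.prob])
    also have "\<dots> = \<P>(\<omega> in M. X \<omega> \<in> {t<..} \<bar> X \<omega> > 0)"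
      by (rule assms(9)) simp
    finally show ?thesis
      by (simp add: cond_prob_def)
  qed
  \<comment> \<open>Otherwise \<open>X\<close> vanishes almost surely, against the positive mean.\<close>
  have p_pos: "0 < ?p"
  proof (rule ccontr)
    assume "\<not> 0 < ?p"
    then have "AE \<omega> in M. X \<omega> \<le> 0"
      using M.prob_Collect_eq_0[of "\<lambda>\<omega>. 0 < X \<omega>"] by (simp add: not_less measure_le_0_iff)
    then have "?m \<le> (\<integral>\<omega>. 0 \<partial>M)"
      using assms(4) by (intro integral_mono_AE) auto
    with assms(5) show False by simp
  qed
  have tail_0: "measure ?\<mu> {t<..} = \<P>(\<omega> in M. max t 0 < X \<omega>)" if "0 \<le> t" for t
    using that by (simp add: tail_X max_absorb1)
  have all_mass: "measure ?\<mu> {t<..} = 1" if "t < 0" for t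
    unfolding tail_X using assms(3) that by (intro M.prob_Collect_eq_1[THEN iffD2]) auto
  have le: "cdf ?\<nu> x \<le> cdf ?\<mu> x" for x
  proof -
    have "measure ?\<mu> {x<..} \<le> measure ?\<nu> {x<..}"
    proof (cases "0 \<le> x")
      case True
      then show ?thesis
        using p_pos M.prob_le_1[of "{\<omega> \<in> space M. 0 < X \<omega>}"]
        by (simp add: tail_0 tail_Y le_divide_eq mult_left_le)
    next
      case False
      then show ?thesis
        using p_pos by (simp add: tail_Y all_mass max_absorb2)
    qed
    then show ?thesis
      by (simp add: \<mu>.cdf_eq_one_minus_tail \<nu>.cdf_eq_one_minus_tail)
  qed
  have shift: "cdf ?\<mu> x \<le> cdf ?\<nu> (x + 1)" for x
  proof -
    \<comment> \<open>The size bias comparison needs a non-negative level; at a negative level \<open>x + 1\<close> the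
      right-hand side is already 1.\<close>
    have "measure ?\<nu> {x + 1<..} \<le> measure ?\<mu> {x<..}"
    proof (cases "0 \<le> x + 1")
      case True
      let ?e = "\<integral>\<omega>. X \<omega> * indicator {x + 1<..} (X \<omega>) \<partial>M"
      have "measure ?\<nu> {x + 1<..} = \<P>(\<omega> in M. x + 1 < X \<omega>) / ?p"
        using True by (simp add: tail_Y max_absorb1)
      also have "\<dots> \<le> ?e / ?m"
        using M.conditional_tail_le_size_bias_tail[OF assms(4,3) True] p_pos assms(5)
        by (simp add: field_simps)
      also have "?e / ?m = (\<integral>z. indicator {x + 1<..} z \<partial>size_bias_law ?\<mu>)"
        using assms(2,3,5) by (intro integral_size_bias_law[symmetric]) auto
      also have "\<dots> = measure (distr N borel Z) {x + 1<..}"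
        by (simp flip: Z)
      also have "\<dots> = \<P>(\<omega> in N. x + 1 < Z \<omega>)"
        by (auto simp: measure_distr intro!: arg_cong[where f = N.prob])
      also have "\<dots> \<le> \<P>(\<omega> in N. x < U \<omega>)"
        using ZU by (intro N.finite_measure_mono_AE) auto
      also have "\<dots> = measure (distr N borel U) {x<..}"
        by (auto simp: measure_distr intro!: arg_cong[where f = N.prob])
      finally show ?thesis
        by (simp add: U)
    next
      case False
      then show ?thesis
        by (simp add: all_mass)
    qed
    then show ?thesis
      by (simp add: \<mu>.cdf_eq_one_minus_tail \<nu>.cdf_eq_one_minus_tail)
  qed
  obtain \<Omega> :: "real measure" and V W where VW: "coupling \<Omega> V W ?\<mu> ?\<nu>"
    and bounds: "\<And>\<omega>. \<omega> \<in> space \<Omega> \<Longrightarrow> W \<omega> - V \<omega> \<in> {0..1}"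
    using quantile_coupling[OF \<mu>.real_distribution_axioms \<nu>.real_distribution_axioms le shift]
    by blast
  have "prob_space \<Omega>"
    using VW by (simp add: coupling_def)
  then have "coupling (\<Omega> \<Otimes>\<^sub>M \<Omega>) (V \<circ> fst) (W \<circ> fst) ?\<mu> ?\<nu>"
    by (rule coupling_fst[OF VW])
  moreover have "\<forall>\<omega>\<in>space (\<Omega> \<Otimes>\<^sub>M \<Omega>). (W \<circ> fst) \<omega> - (V \<circ> fst) \<omega> \<in> {0..1}"
    using bounds by (auto simp: space_pair_measure)
  ultimately show ?thesis
    by blast
qed

end
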